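(* For every $n\ge4$, the set $\Psi_n\subseteq\mathbb{R}^{2^n-1}$ is not convex.
   Context: An object is a bounded compact subset $T\subseteq\mathbb{R}^n_+$. For nonempty $S\subseteq[n]$, $T_S$ is the orthogonal projection of $T$ onto the coordinate subspace spanned by the standard basis vectors $v_i$, $i\in S$, and $|T_S|$ its $|S|$-dimensional volume. $\Psi_n$ is the set of all vectors $\pi\in\mathbb{R}^{2^n-1}$, with entries indexed by nonempty subsets $S\subseteq[n]$, such that there is an object $T$ with $\pi_S=\log|T_S|$ for all nonempty $S\subseteq[n]$. *)

theory Defs
  imports "HOL-Analysis.Analysis"
begin

text \<open>The index set \<open>[n]\<close> is a finite type \<open>'n\<close>, so that \<open>n = CARD('n)\<close>. The coordinates of
  \<open>\<real>\<close> to the power \<open>2\<^sup>n - 1\<close> are indexed by the following type, of cardinality \<open>2\<^sup>n - 1\<close>.\<close>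

typedef 'n nonempty_set = "{S :: 'n set. S \<noteq> {}}"
  morphisms set_of nonempty_set_of
  by blast

instance nonempty_set :: (finite) finite
proof
  have "inj (set_of :: 'a nonempty_set \<Rightarrow> 'a set)"
    by (simp add: inj_def set_of_inject)
  then show "finite (UNIV :: 'a nonempty_set set)"
    by (intro finite_imageD[of set_of UNIV] finite)
qed

definition object :: "(real ^ 'n) set \<Rightarrow> bool" where
  "object T \<longleftrightarrow> bounded T \<and> compact T \<and> T \<subseteq> {x. \<forall>i. 0 \<le> x $ i}"

definition coord_proj :: "'n set \<Rightarrow> real ^ 'n \<Rightarrow> real ^ 'n" where
  "coord_proj S x = (\<chi> i. if i \<in> S then x $ i else 0)"

text \<open>The \<open>|S|\<close>-dimensional volume of a subset of the span of the \<open>v\<^sub>i\<close>, \<open>i \<in> S\<close>: that subspace is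
  identified with \<open>S \<rightarrow>\<^sub>E UNIV\<close> by reading off the coordinates in \<open>S\<close>, and the latter
  carries the product Lebesgue measure.\<close>

definition coord_volume :: "'n::finite set \<Rightarrow> (real ^ 'n) set \<Rightarrow> real" where
  "coord_volume S A = measure (Pi\<^sub>M S (\<lambda>_. lborel)) ((\<lambda>x. \<lambda>i\<in>S. x $ i) ` A)"

text \<open>Since \<open>ln 0 = 0\<close> here, positivity of all the volumes has to be demanded explicitly: an object
  with a projection of volume \<open>0\<close> gives no point with real entries.\<close>

definition Psi :: "(real ^ ('n::finite) nonempty_set) set" where
  "Psi = {p. \<exists>T :: (real ^ 'n) set. object T \<and>
     (\<forall>S. 0 < coord_volume (set_of S) (coord_proj (set_of S) ` T) \<and>
          p $ S = ln (coord_volume (set_of S) (coord_proj (set_of S) ` T)))}"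

text \<open>The number of coordinates is as claimed.\<close>

lemma card_nonempty_set: "CARD('n::finite nonempty_set) = 2 ^ CARD('n) - 1"
proof -
  have "CARD('n nonempty_set) = card {S :: 'n set. S \<noteq> {}}"
    by (rule type_definition.card[OF type_definition_nonempty_set])
  also have "{S :: 'n set. S \<noteq> {}} = UNIV - {{}}"
    by auto
  finally show ?thesis
    by (simp add: card_Diff_subset)
qed

end

theory Submission
  imports Defs
begin

text \<open>
  Equality in the Loomis-Whitney inequality \<open>|T\<^sub>i\<^sub>j\<^sub>k|\<^sup>2 \<le> |T\<^sub>i\<^sub>j| |T\<^sub>i\<^sub>k| |T\<^sub>j\<^sub>k|\<close> forces \<open>T\<^sub>i\<^sub>j\<close> to be
  essentially a rectangle with side ratio \<open>|T\<^sub>i\<^sub>k| / |T\<^sub>j\<^sub>k|\<close>; equality for \<open>i, j, l\<close> forces the ratio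
  \<open>|T\<^sub>i\<^sub>l| / |T\<^sub>j\<^sub>l|\<close>. If these ratios differ strongly, the two equalities exclude each other, even
  approximately: most of \<open>T\<^sub>i\<^sub>j\<close> would have to lie over long slices in direction \<open>i\<close> and most of it
  over long slices in direction \<open>j\<close>, but the part doing both lies in a product of two short sets.

  A union of two boxes, one extremal for \<open>i, j, k\<close> and the other for \<open>i, j, l\<close>, satisfies both
  equalities up to a factor 2. As \<open>0 \<in> \<Psi>\<^sub>n\<close>, convexity would allow taking fourth roots of all
  its volumes, which lowers that factor below the threshold for the contradiction.
\<close>

section \<open>Projected volumes as Lebesgue measure on iterated products\<close>

lemma emeasure_lborel_prod:
  fixes X :: "('a::euclidean_space \<times> 'b::euclidean_space) set"
  assumes "X \<in> sets borel"
  shows "emeasure lborel X = (\<integral>\<^sup>+ x. \<integral>\<^sup>+ y. indicator X (x, y) \<partial>lborel \<partial>lborel)"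
proof -
  have "X \<in> sets (lborel \<Otimes>\<^sub>M lborel)"
    unfolding lborel_prod using assms by simp
  from lborel.emeasure_pair_measure[OF this] show ?thesis
    unfolding lborel_prod .
qed

lemma measurable_PiM_lborel_component:
  "i \<in> I \<Longrightarrow> (\<lambda>f. f i) \<in> PiM I (\<lambda>_. lborel :: real measure) \<rightarrow>\<^sub>M borel"
  using measurable_component_singleton[of i I "\<lambda>_. lborel :: real measure"] by simp

text \<open>Induction step for identifying \<open>PiM\<close> with \<open>lborel\<close> on nested
  pairs, one coordinate at a time. Fubini splits off coordinate \<open>i\<close>; as
  \<open>\<phi>\<close> ignores that coordinate, the remaining integral over \<open>PiM I\<close>
  can be pushed forward along \<open>\<phi>\<close>.\<close>

lemma distr_PiM_lborel_insert:
  fixes \<phi> :: "('i \<Rightarrow> real) \<Rightarrow> 'a::euclidean_space"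
  assumes "finite I" "i \<notin> I"
    and \<phi>[measurable]: "\<phi> \<in> PiM I (\<lambda>_. lborel) \<rightarrow>\<^sub>M borel"
    and distr: "distr (PiM I (\<lambda>_. lborel)) borel \<phi> = lborel"
    and \<phi>': "\<phi> \<in> PiM (insert i I) (\<lambda>_. lborel) \<rightarrow>\<^sub>M borel" "\<And>f y. \<phi> (f(i := y)) = \<phi> f"
  shows "distr (PiM (insert i I) (\<lambda>_. lborel)) borel (\<lambda>f. (\<phi> f, f i)) = lborel"
proof (rule measure_eqI)
  interpret product_sigma_finite "\<lambda>_::'i. lborel :: real measure" ..
  have mi: "(\<lambda>f. f i) \<in> PiM (insert i I) (\<lambda>_. lborel :: real measure) \<rightarrow>\<^sub>M borel"
    by (simp add: measurable_PiM_lborel_component)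
  note \<phi>'(1)[measurable] mi[measurable]
  fix X :: "('a \<times> real) set"
  assume "X \<in> sets (distr (PiM (insert i I) (\<lambda>_. lborel)) borel (\<lambda>f. (\<phi> f, f i)))"
  then have X[measurable]: "X \<in> sets borel" by simp
  have X'[measurable]: "X \<in> sets (borel \<Otimes>\<^sub>M borel)" using X unfolding borel_prod .
  have pm: "(\<lambda>f. (\<phi> f, f i)) \<in> PiM (insert i I) (\<lambda>_. lborel) \<rightarrow>\<^sub>M borel"
    by measurable
  have "emeasure (distr (PiM (insert i I) (\<lambda>_. lborel)) borel (\<lambda>f. (\<phi> f, f i))) X
      = (\<integral>\<^sup>+ z. indicator X z \<partial>distr (PiM (insert i I) (\<lambda>_. lborel)) borel (\<lambda>f. (\<phi> f, f i)))"
    by simp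
  also have "\<dots> = (\<integral>\<^sup>+ f. indicator X (\<phi> f, f i) \<partial>PiM (insert i I) (\<lambda>_. lborel))"
    by (rule nn_integral_distr[OF pm]) simp
  also have "\<dots> = (\<integral>\<^sup>+ f. \<integral>\<^sup>+ y. indicator X (\<phi> f, y) \<partial>lborel \<partial>PiM I (\<lambda>_. lborel))"
    using assms(1,2) by (subst product_nn_integral_insert) (simp_all add: \<phi>'(2))
  also have "\<dots> = (\<integral>\<^sup>+ x. \<integral>\<^sup>+ y. indicator X (x, y) \<partial>lborel \<partial>distr (PiM I (\<lambda>_. lborel)) borel \<phi>)"
    by (subst nn_integral_distr) simp_all
  also have "\<dots> = emeasure lborel X"
    by (simp add: distr emeasure_lborel_prod)
  finally show "emeasure (distr (PiM (insert i I) (\<lambda>_. lborel)) borel (\<lambda>f. (\<phi> f, f i))) X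
      = emeasure lborel X" .
qed simp

lemma distr_PiM_lborel_2:
  assumes "i \<noteq> j"
  shows "distr (PiM {i, j} (\<lambda>_. lborel)) borel (\<lambda>f. (f i, f j)) = (lborel :: (real \<times> real) measure)"
proof -
  interpret product_sigma_finite "\<lambda>_::'a. lborel :: real measure" ..
  have "distr (PiM {i} (\<lambda>_. lborel)) borel (\<lambda>f. f i) = (lborel :: real measure)"
    using distr_singleton[of i] by (simp cong: distr_cong)
  from distr_PiM_lborel_insert[OF _ _ _ this, of j] assms show ?thesis
    by (simp add: insert_commute measurable_PiM_lborel_component)
qed

lemma distr_PiM_lborel_3:
  assumes "i \<noteq> j" "i \<noteq> k" "j \<noteq> k"
  shows "distr (PiM {i, j, k} (\<lambda>_. lborel)) borel (\<lambda>f. ((f i, f j), f k))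
    = (lborel :: ((real \<times> real) \<times> real) measure)"
proof -
  have m: "(\<lambda>f. (f i, f j)) \<in> PiM I (\<lambda>_. lborel :: real measure) \<rightarrow>\<^sub>M borel" if "{i, j} \<subseteq> I" for I
    using that by (intro borel_measurable_Pair measurable_PiM_lborel_component) auto
  have "insert k {i, j} = {i, j, k}" by auto
  with distr_PiM_lborel_insert[OF _ _ m distr_PiM_lborel_2, of k] m[of "{i, j, k}"] assms
  show ?thesis by simp
qed

text \<open>\<open>\<phi>\<close> and \<open>\<psi>\<close> read the same coordinates, off a
  function on \<open>S\<close> and off a vector. Injectivity of \<open>\<phi>\<close> on extensional
  functions makes the preimage of \<open>\<psi>\<close>
  T\<open>exactly the set measured by\<close>coord_volume\<open>, and compactness of\<close>T\<open>makes\<close>\<psi>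
  \<open>T\<close> Borel, so the pushforward identity applies.\<close>

lemma coord_volume_eq_measure_lborel:
  fixes \<psi> :: "real ^ 'n \<Rightarrow> 'a::euclidean_space" and \<phi> :: "('n::finite \<Rightarrow> real) \<Rightarrow> 'a"
  assumes distr: "distr (PiM S (\<lambda>_. lborel)) borel \<phi> = lborel"
    and \<phi>: "\<phi> \<in> PiM S (\<lambda>_. lborel) \<rightarrow>\<^sub>M borel"
    and inj: "inj_on \<phi> (S \<rightarrow>\<^sub>E UNIV)"
    and \<psi>: "continuous_on UNIV \<psi>" "\<And>x. \<phi> (\<lambda>i\<in>S. x $ i) = \<psi> x"
    and "compact T"
  shows "coord_volume S (coord_proj S ` T) = measure lborel (\<psi> ` T)"
proof -
  have "compact (\<psi> ` T)"
    using \<psi>(1) \<open>compact T\<close> by (meson compact_continuous_image continuous_on_subset subset_UNIV)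
  then have "measure lborel (\<psi> ` T) = measure (PiM S (\<lambda>_. lborel)) (\<phi> -` (\<psi> ` T) \<inter> space (PiM S (\<lambda>_. lborel)))"
    by (subst distr[symmetric]) (simp add: measure_distr[OF \<phi>] borel_compact)
  also have "\<phi> -` (\<psi> ` T) \<inter> space (PiM S (\<lambda>_. lborel)) = (\<lambda>x. \<lambda>i\<in>S. x $ i) ` coord_proj S ` T"
  proof -
    have [simp]: "(\<lambda>i\<in>S. coord_proj S x $ i) = (\<lambda>i\<in>S. x $ i)" for x :: "real ^ 'n"
      by (auto simp: coord_proj_def)
    have "(\<lambda>i\<in>S. x $ i) = f" if "\<phi> f = \<psi> x" "f \<in> S \<rightarrow>\<^sub>E UNIV" for f x
      using inj_onD[OF inj, of "\<lambda>i\<in>S. x $ i" f] that by (simp add: \<psi>(2))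
    then show ?thesis
      by (fastforce simp: space_PiM image_image \<psi>(2))
  qed
  finally show ?thesis
    by (simp add: coord_volume_def)
qed

lemma coord_volume_2:
  fixes T :: "(real ^ 'n::finite) set"
  assumes "i \<noteq> j" "compact T"
  shows "coord_volume {i, j} (coord_proj {i, j} ` T) = measure lborel ((\<lambda>t. (t $ i, t $ j)) ` T)"
proof (rule coord_volume_eq_measure_lborel[OF distr_PiM_lborel_2[OF assms(1)] _ _ _ _ assms(2)])
  show "(\<lambda>f. (f i, f j)) \<in> PiM {i, j} (\<lambda>_. lborel :: real measure) \<rightarrow>\<^sub>M borel"
    by (intro borel_measurable_Pair measurable_PiM_lborel_component) simp_all
  show "inj_on (\<lambda>f. (f i, f j) :: real \<times> real) ({i, j} \<rightarrow>\<^sub>E UNIV)"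
    by (rule inj_onI, rule PiE_ext) auto
qed (auto intro!: continuous_intros)

lemma coord_volume_3:
  fixes T :: "(real ^ 'n::finite) set"
  assumes "i \<noteq> j" "i \<noteq> k" "j \<noteq> k" "compact T"
  shows "coord_volume {i, j, k} (coord_proj {i, j, k} ` T)
    = measure lborel ((\<lambda>t. ((t $ i, t $ j), t $ k)) ` T)"
proof (rule coord_volume_eq_measure_lborel[OF distr_PiM_lborel_3[OF assms(1-3)] _ _ _ _ assms(4)])
  show "(\<lambda>f. ((f i, f j), f k)) \<in> PiM {i, j, k} (\<lambda>_. lborel :: real measure) \<rightarrow>\<^sub>M borel"
    by (intro borel_measurable_Pair measurable_PiM_lborel_component) simp_all
  show "inj_on (\<lambda>f. ((f i, f j), f k) :: (real \<times> real) \<times> real) ({i, j, k} \<rightarrow>\<^sub>E UNIV)"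
    by (rule inj_onI, rule PiE_ext) auto
qed (auto intro!: continuous_intros)

section \<open>Loomis-Whitney and its near-equality case\<close>

text \<open>Cauchy-Schwarz twice: over the plane it separates \<open>A\<close> from the fibre length
  \<open>h\<close>, and along each fibre it bounds \<open>h\<close> squared by a product of slice
  lengths of \<open>B\<close> and \<open>C\<close>, which integrates to the product of their areas.
  \<open>A\<close> is an arbitrary Borel set, so that it can later be cut down to a strip.\<close>

lemma loomis_whitney_emeasure:
  fixes A B C :: "(real \<times> real) set"
  assumes [measurable]: "A \<in> sets borel" "B \<in> sets borel" "C \<in> sets borel"
  shows "(emeasure lborel {((x, y), z). (x, y) \<in> A \<and> (x, z) \<in> B \<and> (y, z) \<in> C})\<^sup>2
    \<le> emeasure lborel A * (emeasure lborel B * emeasure lborel C)"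
proof -
  have [measurable]: "A \<in> sets (borel \<Otimes>\<^sub>M borel)" "B \<in> sets (borel \<Otimes>\<^sub>M borel)" "C \<in> sets (borel \<Otimes>\<^sub>M borel)"
    unfolding borel_prod by fact+
  \<comment> \<open>The length of the fibre over \<open>p\<close> that \<open>B\<close> and
    \<open>C\<close> alone permit.\<close>
  define h :: "real \<times> real \<Rightarrow> ennreal"
    where "h p = (\<integral>\<^sup>+ z. indicator B (fst p, z) * indicator C (snd p, z) \<partial>lborel)" for p
  define f g :: "real \<Rightarrow> ennreal" where "f x = (\<integral>\<^sup>+ z. indicator B (x, z) \<partial>lborel)"
    and "g y = (\<integral>\<^sup>+ z. indicator C (y, z) \<partial>lborel)" for x y
  have [measurable]: "f \<in> borel_measurable borel" "g \<in> borel_measurable borel"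
    unfolding f_def g_def by measurable
  have hm[measurable]: "h \<in> borel_measurable (borel \<Otimes>\<^sub>M borel)"
    unfolding h_def by measurable
  let ?W = "{((x, y), z). (x, y) \<in> A \<and> (x, z) \<in> B \<and> (y, z) \<in> C}"
  have "?W = {p \<in> space ((borel \<Otimes>\<^sub>M borel) \<Otimes>\<^sub>M borel).
      fst p \<in> A \<and> (fst (fst p), snd p) \<in> B \<and> (snd (fst p), snd p) \<in> C}"
    by (auto simp: space_pair_measure)
  also have "\<dots> \<in> sets ((borel \<Otimes>\<^sub>M borel) \<Otimes>\<^sub>M borel)"
    by measurable
  finally have "?W \<in> sets borel"
    unfolding borel_prod .
  then have "emeasure lborel ?W = (\<integral>\<^sup>+ p. \<integral>\<^sup>+ z. indicator ?W (p, z) \<partial>lborel \<partial>lborel)"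
    by (rule emeasure_lborel_prod)
  also have "\<dots> = (\<integral>\<^sup>+ p. \<integral>\<^sup>+ z. indicator A p * (indicator B (fst p, z) * indicator C (snd p, z)) \<partial>lborel \<partial>lborel)"
    by (intro nn_integral_cong) (auto simp: indicator_def split: prod.splits)
  also have "\<dots> = (\<integral>\<^sup>+ p. indicator A p * h p \<partial>lborel)"
    unfolding h_def by (intro nn_integral_cong nn_integral_cmult) measurable
  finally have "(emeasure lborel ?W)\<^sup>2 = (\<integral>\<^sup>+ p. indicator A p * h p \<partial>lborel)\<^sup>2"
    by simp
  also have "\<dots> \<le> (\<integral>\<^sup>+ p. (indicator A p)\<^sup>2 \<partial>lborel) * (\<integral>\<^sup>+ p. (h p)\<^sup>2 \<partial>lborel)"
    using hm by (intro Cauchy_Schwarz_nn_integral) (auto simp: borel_prod)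
  also have "(\<integral>\<^sup>+ p. (indicator A p)\<^sup>2 \<partial>lborel) = (\<integral>\<^sup>+ p. indicator A p \<partial>lborel)"
    by (intro nn_integral_cong) (simp add: indicator_def)
  also have "\<dots> = emeasure lborel A"
    by simp
  also have "(\<integral>\<^sup>+ p. (h p)\<^sup>2 \<partial>lborel) \<le> emeasure lborel B * emeasure lborel C"
  proof -
    have "(h p)\<^sup>2 \<le> f (fst p) * g (snd p)" for p
    proof -
      have "(h p)\<^sup>2 \<le> (\<integral>\<^sup>+ z. (indicator B (fst p, z))\<^sup>2 \<partial>lborel) * (\<integral>\<^sup>+ z. (indicator C (snd p, z))\<^sup>2 \<partial>lborel)"
        unfolding h_def by (intro Cauchy_Schwarz_nn_integral) measurable
      also have "\<dots> = f (fst p) * g (snd p)"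
        unfolding f_def g_def by (intro arg_cong2[of _ _ _ _ "(*)"] nn_integral_cong) (simp_all add: indicator_def)
      finally show ?thesis .
    qed
    then have "(\<integral>\<^sup>+ p. (h p)\<^sup>2 \<partial>lborel) \<le> (\<integral>\<^sup>+ p. f (fst p) * g (snd p) \<partial>(lborel \<Otimes>\<^sub>M lborel))"
      unfolding lborel_prod by (intro nn_integral_mono)
    also have "\<dots> = (\<integral>\<^sup>+ x. \<integral>\<^sup>+ y. f x * g y \<partial>lborel \<partial>lborel)"
      by (subst lborel.nn_integral_fst[symmetric]) simp_all
    also have "\<dots> = emeasure lborel B * emeasure lborel C"
      by (simp add: nn_integral_cmult nn_integral_multc emeasure_lborel_prod f_def[symmetric] g_def[symmetric])
    finally show ?thesis .
  qed
  finally show ?thesis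
    by (simp add: mult_left_mono)
qed

text \<open>Integrating over \<open>x\<close> before \<open>y\<close> bounds each slice of
  \<open>A\<close> by \<open>\<tau>\<close>, and what remains integrates to the area of
  \<open>C\<close>. When \<open>C\<close> is small, the part of the body over short slices is
  therefore negligible.\<close>

lemma emeasure_over_short_slices_le:
  fixes A C :: "(real \<times> real) set"
  assumes [measurable]: "A \<in> sets borel" "C \<in> sets borel" "N \<in> sets borel"
    and short: "\<And>y. y \<in> N \<Longrightarrow> emeasure lborel {x. (x, y) \<in> A} \<le> \<tau>"
  shows "emeasure lborel {((x, y), z). (x, y) \<in> A \<and> y \<in> N \<and> (y, z) \<in> C} \<le> \<tau> * emeasure lborel C"
proof -
  have [measurable]: "A \<in> sets (borel \<Otimes>\<^sub>M borel)" "C \<in> sets (borel \<Otimes>\<^sub>M borel)"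
    unfolding borel_prod by fact+
  define g :: "real \<Rightarrow> ennreal" where "g y = (\<integral>\<^sup>+ z. indicator C (y, z) \<partial>lborel)" for y
  have [measurable]: "g \<in> borel_measurable borel"
    unfolding g_def by measurable
  let ?W = "{((x, y), z). (x, y) \<in> A \<and> y \<in> N \<and> (y, z) \<in> C}"
  have "?W = {p \<in> space ((borel \<Otimes>\<^sub>M borel) \<Otimes>\<^sub>M borel).
      fst p \<in> A \<and> snd (fst p) \<in> N \<and> (snd (fst p), snd p) \<in> C}"
    by (auto simp: space_pair_measure)
  also have "\<dots> \<in> sets ((borel \<Otimes>\<^sub>M borel) \<Otimes>\<^sub>M borel)"
    by measurable
  finally have "?W \<in> sets borel"
    unfolding borel_prod .
  then have "emeasure lborel ?W = (\<integral>\<^sup>+ p. \<integral>\<^sup>+ z. indicator ?W (p, z) \<partial>lborel \<partial>lborel)"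
    by (rule emeasure_lborel_prod)
  also have "\<dots> = (\<integral>\<^sup>+ p. \<integral>\<^sup>+ z. indicator A p * indicator N (snd p) * indicator C (snd p, z) \<partial>lborel \<partial>(lborel \<Otimes>\<^sub>M lborel))"
    unfolding lborel_prod by (intro nn_integral_cong) (auto simp: indicator_def split: prod.splits)
  also have "\<dots> = (\<integral>\<^sup>+ p. indicator A p * indicator N (snd p) * g (snd p) \<partial>(lborel \<Otimes>\<^sub>M lborel))"
    unfolding g_def by (intro nn_integral_cong nn_integral_cmult) measurable
  also have "\<dots> = (\<integral>\<^sup>+ y. \<integral>\<^sup>+ x. indicator A (x, y) * indicator N y * g y \<partial>lborel \<partial>lborel)"
    by (subst lborel_pair.nn_integral_snd[symmetric]) simp_all
  also have "\<dots> = (\<integral>\<^sup>+ y. (\<integral>\<^sup>+ x. indicator {x. (x, y) \<in> A} x \<partial>lborel) * indicator N y * g y \<partial>lborel)"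
    by (intro nn_integral_cong) (simp add: nn_integral_multc indicator_def)
  also have "\<dots> \<le> (\<integral>\<^sup>+ y. \<tau> * g y \<partial>lborel)"
  proof (intro nn_integral_mono)
    fix y :: real
    have "{x. (x, y) \<in> A} = (\<lambda>x. (x, y)) -` A" by auto
    then have "{x. (x, y) \<in> A} \<in> sets borel"
      using sets_Pair2[of A borel borel y] by simp
    then have "(\<integral>\<^sup>+ x. indicator {x. (x, y) \<in> A} x \<partial>lborel) = emeasure lborel {x. (x, y) \<in> A}"
      by simp
    then show "(\<integral>\<^sup>+ x. indicator {x. (x, y) \<in> A} x \<partial>lborel) * indicator N y * g y \<le> \<tau> * g y"
      using short[of y] by (auto intro!: mult_right_mono simp: indicator_def)
  qed
  also have "\<dots> = \<tau> * emeasure lborel C"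
    by (simp add: nn_integral_cmult emeasure_lborel_prod g_def[symmetric])
  finally show ?thesis .
qed

text \<open>\<open>Y\<close> collects the heights at which the slice of \<open>A\<close> is longer
  than \<open>\<tau>\<close>; Markov's inequality bounds its length. Over the complement of
  \<open>Y\<close> the short-slice bound applies, over \<open>Y\<close> Loomis-Whitney with
  \<open>A\<close> cut down to the strip. If \<open>W\<close> is large and \<open>C\<close> small,
  the strip must hold much of \<open>A\<close>.\<close>

lemma measure_le_wide_part:
  fixes A B C :: "(real \<times> real) set" and W :: "((real \<times> real) \<times> real) set" and \<tau> :: real
  assumes "compact A" "compact B" "compact C" "0 < \<tau>"
    and W: "\<And>x y z. ((x, y), z) \<in> W \<Longrightarrow> (x, y) \<in> A \<and> (x, z) \<in> B \<and> (y, z) \<in> C"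
  obtains Y where "Y \<in> sets borel" "emeasure lborel Y \<le> ennreal (measure lborel A / \<tau>)"
    "measure lborel W
      \<le> \<tau> * measure lborel C + sqrt (measure lborel (A \<inter> UNIV \<times> Y) * (measure lborel B * measure lborel C))"
proof
  have [measurable]: "A \<in> sets borel" "B \<in> sets borel" "C \<in> sets borel"
    using assms by (simp_all add: borel_compact)
  have A'[measurable]: "A \<in> sets (borel \<Otimes>\<^sub>M borel)" "B \<in> sets (borel \<Otimes>\<^sub>M borel)" "C \<in> sets (borel \<Otimes>\<^sub>M borel)"
    unfolding borel_prod by fact+
  have fin: "emeasure lborel A = ennreal (measure lborel A)"
    "emeasure lborel B = ennreal (measure lborel B)" "emeasure lborel C = ennreal (measure lborel C)"
    using assms(1-3) emeasure_compact_finite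
    by (intro emeasure_eq_ennreal_measure; fastforce)+
  define s where "s y = emeasure lborel {x. (x, y) \<in> A}" for y
  have s_alt: "s y = (\<integral>\<^sup>+ x. indicator A (x, y) \<partial>lborel)" for y
  proof -
    have eq: "{x. (x, y) \<in> A} = (\<lambda>x. (x, y)) -` A" by auto
    have "{x. (x, y) \<in> A} \<in> sets borel"
      unfolding eq using sets_Pair2[OF A'(1)] by simp
    then have "s y = (\<integral>\<^sup>+ x. indicator {x. (x, y) \<in> A} x \<partial>lborel)"
      by (simp add: s_def)
    then show ?thesis by (simp add: indicator_def)
  qed
  have [measurable]: "s \<in> borel_measurable borel"
    unfolding s_alt by measurable
  define Y where "Y = {y. ennreal \<tau> < s y}"
  show Y[measurable]: "Y \<in> sets borel"
    unfolding Y_def by measurable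
  have "ennreal \<tau> * emeasure lborel Y = (\<integral>\<^sup>+ y. ennreal \<tau> * indicator Y y \<partial>lborel)"
    by (simp add: nn_integral_cmult)
  also have "\<dots> \<le> (\<integral>\<^sup>+ y. s y \<partial>lborel)"
    by (intro nn_integral_mono) (auto simp: Y_def indicator_def)
  also have "\<dots> = (\<integral>\<^sup>+ p. indicator A p \<partial>(lborel \<Otimes>\<^sub>M lborel))"
    unfolding s_alt by (subst lborel_pair.nn_integral_snd[symmetric]) simp_all
  also have "\<dots> = ennreal (measure lborel A)"
    unfolding lborel_prod by (simp add: fin(1))
  finally have "ennreal (1 / \<tau>) * (ennreal \<tau> * emeasure lborel Y) \<le> ennreal (1 / \<tau>) * ennreal (measure lborel A)"
    by (rule mult_left_mono) simp
  then show "emeasure lborel Y \<le> ennreal (measure lborel A / \<tau>)"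
    using \<open>0 < \<tau>\<close> by (simp add: mult.assoc[symmetric] ennreal_mult'[symmetric])
  \<comment> \<open>\<open>?W0\<close> drops the constraint from \<open>B\<close>, which the
    short-slice bound does not involve; \<open>?W1\<close> keeps all three.\<close>
  let ?W0 = "{((x, y), z). (x, y) \<in> A \<and> y \<in> - Y \<and> (y, z) \<in> C}"
  let ?W1 = "{((x, y), z). (x, y) \<in> A \<inter> UNIV \<times> Y \<and> (x, z) \<in> B \<and> (y, z) \<in> C}"
  have AY: "A \<inter> UNIV \<times> Y \<in> sets borel"
  proof -
    have "A \<inter> UNIV \<times> Y \<in> sets (borel \<Otimes>\<^sub>M borel)" by measurable
    then show ?thesis unfolding borel_prod .
  qed
  have finAY: "emeasure lborel (A \<inter> UNIV \<times> Y) = ennreal (measure lborel (A \<inter> UNIV \<times> Y))"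
  proof (rule emeasure_eq_ennreal_measure)
    have "emeasure lborel (A \<inter> UNIV \<times> Y) \<le> emeasure lborel A"
      by (rule emeasure_mono) auto
    then show "emeasure lborel (A \<inter> UNIV \<times> Y) \<noteq> top"
      by (auto simp: fin top_unique)
  qed
  have W0: "emeasure lborel ?W0 \<le> ennreal (\<tau> * measure lborel C)"
    using emeasure_over_short_slices_le[of A C "- Y" "ennreal \<tau>"] \<open>0 < \<tau>\<close>
    by (auto simp: Y_def s_def[symmetric] not_less fin ennreal_mult')
  have "(emeasure lborel ?W1)\<^sup>2
      \<le> ennreal (measure lborel (A \<inter> UNIV \<times> Y) * (measure lborel B * measure lborel C))"
    using loomis_whitney_emeasure[OF AY, of B C] by (simp only: finAY fin) (simp add: ennreal_mult')
  then have W1: "emeasure lborel ?W1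
      \<le> ennreal (sqrt (measure lborel (A \<inter> UNIV \<times> Y) * (measure lborel B * measure lborel C)))" (is "_ \<le> ennreal (sqrt ?r)")
  \<comment> \<open>Finiteness must come first: only then does the bound on the square become one
    between reals, where a root can be taken.\<close>
  proof -
    assume *: "(emeasure lborel ?W1)\<^sup>2 \<le> ennreal ?r"
    then have "emeasure lborel ?W1 \<noteq> top"
      by (auto simp: top_unique power2_eq_square)
    then obtain w where w: "emeasure lborel ?W1 = ennreal w" "0 \<le> w"
      by (cases "emeasure lborel ?W1") auto
    with * have "w\<^sup>2 \<le> ?r"
      by (simp add: ennreal_power)
    with w show ?thesis
      by (simp add: real_le_rsqrt ennreal_leI)
  qed
  have meas0: "?W0 \<in> sets borel"
  proof -
    have "?W0 = {p \<in> space ((borel \<Otimes>\<^sub>M borel) \<Otimes>\<^sub>M borel).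
        fst p \<in> A \<and> snd (fst p) \<in> - Y \<and> (snd (fst p), snd p) \<in> C}"
      by (auto simp: space_pair_measure)
    also have "\<dots> \<in> sets ((borel \<Otimes>\<^sub>M borel) \<Otimes>\<^sub>M borel)"
      by measurable
    finally show ?thesis unfolding borel_prod .
  qed
  have meas1: "?W1 \<in> sets borel"
  proof -
    have "?W1 = {p \<in> space ((borel \<Otimes>\<^sub>M borel) \<Otimes>\<^sub>M borel).
        fst p \<in> A \<and> snd (fst p) \<in> Y \<and> (fst (fst p), snd p) \<in> B \<and> (snd (fst p), snd p) \<in> C}"
      by (auto simp: space_pair_measure)
    also have "\<dots> \<in> sets ((borel \<Otimes>\<^sub>M borel) \<Otimes>\<^sub>M borel)"
      by measurable
    finally show ?thesis unfolding borel_prod .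
  qed
  have "W \<subseteq> ?W0 \<union> ?W1"
    using W by fastforce
  \<comment> \<open>If \<open>W\<close> is not measurable, its \<open>emeasure\<close> is 0 by
    default; monotonicity asks for measurability of the larger set only.\<close>
  then have "emeasure lborel W \<le> emeasure lborel (?W0 \<union> ?W1)"
    using meas0 meas1 by (intro emeasure_mono) auto
  also have "\<dots> \<le> emeasure lborel ?W0 + emeasure lborel ?W1"
    using meas0 meas1 by (intro emeasure_subadditive) auto
  also have "\<dots> \<le> ennreal (\<tau> * measure lborel C) + ennreal (sqrt ?r)"
    by (rule add_mono[OF W0 W1])
  also have "\<dots> = ennreal (\<tau> * measure lborel C + sqrt ?r)"
    using \<open>0 < \<tau>\<close> by (simp add: ennreal_plus)
  finally show "measure lborel W \<le> \<tau> * measure lborel C + sqrt ?r"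
    unfolding measure_def[of lborel W] using \<open>0 < \<tau>\<close> by (intro enn2real_leI) simp_all
qed

section \<open>Crossing strips, and incompatibility of two near-equalities\<close>

lemma measure_lborel_swap:
  fixes A :: "(real \<times> real) set"
  assumes "A \<in> sets borel"
  shows "measure lborel (prod.swap ` A) = measure lborel A"
proof -
  have [measurable]: "A \<in> sets (borel \<Otimes>\<^sub>M borel)"
    unfolding borel_prod by fact
  have d: "lborel = distr lborel lborel (\<lambda>(x, y). (y, x) :: real \<times> real)"
    using lborel_pair.distr_pair_swap[where 'a = real and 'b = real] unfolding lborel_prod .
  have "(\<lambda>(x, y). (y, x)) \<in> lborel \<rightarrow>\<^sub>M (lborel :: (real \<times> real) measure)"
    unfolding lborel_prod[symmetric] by measurable
  then have "measure lborel A = measure lborel ((\<lambda>(x, y). (y, x)) -` A)"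
    using assms by (subst d) (simp add: measure_distr)
  also have "(\<lambda>(x, y). (y, x)) -` A = prod.swap ` A"
    by (force simp: prod.swap_def)
  finally show ?thesis by simp
qed

text \<open>Inclusion-exclusion: the union of the two parts lies in \<open>A\<close>, and their
  overlap lies in the small rectangle \<open>X \<times> Y\<close>.\<close>

lemma measure_Int_strips_le:
  fixes A :: "(real \<times> real) set"
  assumes "compact A" and XY: "X \<in> sets borel" "Y \<in> sets borel"
    and le: "emeasure lborel X \<le> ennreal u" "emeasure lborel Y \<le> ennreal v" "0 \<le> u" "0 \<le> v"
  shows "measure lborel (A \<inter> X \<times> UNIV) + measure lborel (A \<inter> UNIV \<times> Y) \<le> measure lborel A + u * v"
proof -
  note [measurable] = XY
  have "A \<in> sets borel"
    using \<open>compact A\<close> by (rule borel_compact)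
  then have [measurable]: "A \<in> sets (borel \<Otimes>\<^sub>M borel)"
    unfolding borel_prod .
  have "A \<inter> X \<times> UNIV \<in> sets (borel \<Otimes>\<^sub>M borel)" "A \<inter> UNIV \<times> Y \<in> sets (borel \<Otimes>\<^sub>M borel)"
    "X \<times> Y \<in> sets (borel \<Otimes>\<^sub>M borel)"
    by measurable
  then have sets: "A \<inter> X \<times> UNIV \<in> sets borel" "A \<inter> UNIV \<times> Y \<in> sets borel" "X \<times> Y \<in> sets borel"
    unfolding borel_prod .
  have A: "A \<in> fmeasurable lborel"
    using \<open>compact A\<close> by (rule fmeasurable_compact)
  have fm: "A \<inter> X \<times> UNIV \<in> fmeasurable lborel" "A \<inter> UNIV \<times> Y \<in> fmeasurable lborel"
    using sets by (auto intro: fmeasurableI2[OF A])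
  have "emeasure lborel (X \<times> Y) = emeasure lborel X * emeasure lborel Y"
    unfolding lborel_prod[symmetric] using XY by (simp add: lborel.emeasure_pair_measure_Times)
  also have "\<dots> \<le> ennreal (u * v)"
    using le by (simp add: ennreal_mult' mult_mono)
  finally have eXY: "emeasure lborel (X \<times> Y) \<le> ennreal (u * v)" .
  then have fXY: "X \<times> Y \<in> fmeasurable lborel"
    using sets(3) by (intro fmeasurableI) (auto simp: le_less_trans)
  have mXY: "measure lborel (X \<times> Y) \<le> u * v"
    unfolding measure_def using le eXY by (intro enn2real_leI) simp_all
  have "measure lborel (A \<inter> X \<times> UNIV) + measure lborel (A \<inter> UNIV \<times> Y)
      = measure lborel (A \<inter> X \<times> UNIV \<union> A \<inter> UNIV \<times> Y) + measure lborel (A \<inter> X \<times> UNIV \<inter> (A \<inter> UNIV \<times> Y))"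
    using measure_Un3[OF fm] by simp
  also have "\<dots> \<le> measure lborel A + measure lborel (X \<times> Y)"
    using sets A fXY by (intro add_mono measure_mono_fmeasurable) auto
  finally show ?thesis
    using mXY by simp
qed

text \<open>With \<open>c = 6/5\<close> and \<open>m = 1000\<close> the bounds are \<open>c\<close>, \<open>c m\<close> and \<open>c / m\<close>. The argument, with slices
  counted as long from length 10 on, needs \<open>c\<^sup>3 < 2\<close> and \<open>m\<close> large.\<close>

lemma near_extremal_volumes_incompatible:
  fixes T :: "(real ^ 'n::finite) set" and i j k l :: 'n
  defines "V \<equiv> \<lambda>S. coord_volume S (coord_proj S ` T)"
  assumes "compact T" and distinct: "distinct [i, j, k, l]"
    and "V {i, j} \<le> 6/5" "V {i, k} \<le> 1200" "V {j, k} \<le> 6/5000" "V {i, l} \<le> 6/5000" "V {j, l} \<le> 1200"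
  shows "V {i, j, k} < 1 \<or> V {i, j, l} < 1"
proof (rule ccontr)
  define P2 where "P2 a b = (\<lambda>t :: real ^ 'n. (t $ a, t $ b)) ` T" for a b
  define P3 where "P3 a b c = (\<lambda>t :: real ^ 'n. ((t $ a, t $ b), t $ c)) ` T" for a b c
  have V2: "V {a, b} = measure lborel (P2 a b)" if "a \<noteq> b" for a b
    unfolding V_def P2_def using that \<open>compact T\<close> by (rule coord_volume_2)
  have V3: "V {a, b, c} = measure lborel (P3 a b c)" if "a \<noteq> b" "a \<noteq> c" "b \<noteq> c" for a b c
    unfolding V_def P3_def using that \<open>compact T\<close> by (rule coord_volume_3)
  have cpt: "compact (P2 a b)" for a b
    unfolding P2_def using \<open>compact T\<close> by (intro compact_continuous_image continuous_intros)
  assume "\<not> ?thesis"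
  \<comment> \<open>Exchanging \<open>i\<close> and \<open>j\<close> in the second triple gives both
    triples the same pattern of bounds, so that \<open>wide\<close> serves for both.\<close>
  then have ge: "1 \<le> measure lborel (P3 i j k)" "1 \<le> measure lborel (P3 j i l)"
    using distinct V3[of i j k] V3[of j i l] by (auto simp: insert_commute)
  have le: "measure lborel (P2 i j) \<le> 6/5" "measure lborel (P2 j i) \<le> 6/5"
    "measure lborel (P2 i k) \<le> 1200" "measure lborel (P2 j k) \<le> 6/5000"
    "measure lborel (P2 i l) \<le> 6/5000" "measure lborel (P2 j l) \<le> 1200"
    using assms(4-8) distinct V2[of i j] V2[of j i] V2[of i k] V2[of j k] V2[of i l] V2[of j l]
    by (auto simp: insert_commute)
  \<comment> \<open>With threshold 10, Markov gives \<open>(6/5) / 10 = 3/25\<close>. The short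
    slices contribute at most \<open>10 * 6/5000 = 12/1000\<close>, which leaves
    \<open>988/1000\<close> for the strip. The product of the other two areas is at most
    \<open>1200 * (6/5000) = 36/25\<close>, and \<open>(988/1000)\<^sup>2 / (36/25)\<close> exceeds
    \<open>67/100\<close>.\<close>
  have wide: "\<exists>Y. Y \<in> sets borel \<and> emeasure lborel Y \<le> ennreal (3/25)
      \<and> 67/100 \<le> measure lborel (P2 a b \<inter> UNIV \<times> Y)"
    if "1 \<le> measure lborel (P3 a b c)" "measure lborel (P2 a b) \<le> 6/5"
      "measure lborel (P2 a c) \<le> 1200" "measure lborel (P2 b c) \<le> 6/5000" for a b c
  proof -
    have sub: "(x, y) \<in> P2 a b \<and> (x, z) \<in> P2 a c \<and> (y, z) \<in> P2 b c" if "((x, y), z) \<in> P3 a b c" for x y z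
      using that by (auto simp: P2_def P3_def)
    obtain Y where Y: "Y \<in> sets borel" "emeasure lborel Y \<le> ennreal (measure lborel (P2 a b) / 10)"
      "measure lborel (P3 a b c) \<le> 10 * measure lborel (P2 b c)
        + sqrt (measure lborel (P2 a b \<inter> UNIV \<times> Y) * (measure lborel (P2 a c) * measure lborel (P2 b c)))"
      by (rule measure_le_wide_part[OF cpt cpt cpt zero_less_numeral sub])
    define q where "q = measure lborel (P2 a b \<inter> UNIV \<times> Y)"
    have "measure lborel (P2 a c) * measure lborel (P2 b c) \<le> 1200 * (6/5000)"
      using that by (intro mult_mono) simp_all
    also have "\<dots> = 36/25" by simp
    finally have "measure lborel (P2 a c) * measure lborel (P2 b c) \<le> 36/25" .
    then have "sqrt (q * (measure lborel (P2 a c) * measure lborel (P2 b c))) \<le> sqrt (q * (36/25))"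
      by (intro real_sqrt_le_mono mult_left_mono) (simp_all add: q_def)
    with Y(3) that have "988/1000 \<le> sqrt (q * (36/25))"
      unfolding q_def by linarith
    then have "(988/1000)\<^sup>2 \<le> q * (36/25)"
      by (intro sqrt_ge_absD) simp
    then have "67/100 \<le> q"
      by (simp add: power2_eq_square)
    moreover have "ennreal (measure lborel (P2 a b) / 10) \<le> ennreal (3/25)"
      using that by (intro ennreal_leI) simp
    ultimately show ?thesis
      using Y(1) order_trans[OF Y(2)] unfolding q_def by blast
  qed
  obtain Y where Y: "Y \<in> sets borel" "emeasure lborel Y \<le> ennreal (3/25)"
    "67/100 \<le> measure lborel (P2 i j \<inter> UNIV \<times> Y)"
    using wide[of i j k] ge le by blast
  obtain X where X: "X \<in> sets borel" "emeasure lborel X \<le> ennreal (3/25)"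
    "67/100 \<le> measure lborel (P2 j i \<inter> UNIV \<times> X)"
    using wide[of j i l] ge le by blast
  have "P2 i j \<inter> X \<times> UNIV \<in> sets borel"
  proof -
    have "P2 i j \<in> sets (borel \<Otimes>\<^sub>M borel)"
      unfolding borel_prod by (rule borel_compact[OF cpt])
    then have "P2 i j \<inter> X \<times> UNIV \<in> sets (borel \<Otimes>\<^sub>M borel)"
      using X(1) by (intro sets.Int pair_measureI) auto
    then show ?thesis unfolding borel_prod .
  qed
  \<comment> \<open>Reflection turns the strip found in \<open>P2 j i\<close> into a strip of
    \<open>P2 i j\<close> in the other direction.\<close>
  from measure_lborel_swap[OF this]
  have "measure lborel (P2 j i \<inter> UNIV \<times> X) = measure lborel (P2 i j \<inter> X \<times> UNIV)"
    by (rule trans[rotated]) (rule arg_cong[of _ _ "measure lborel"], force simp: P2_def prod.swap_def)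
  \<comment> \<open>The strips together have area at least 1.34, but inclusion-exclusion allows at
    most \<open>6/5 + (3/25)\<^sup>2 = 1.2144\<close>.\<close>
  with measure_Int_strips_le[OF cpt X(1) Y(1) X(2) Y(2), of i j] X(3) Y(3) le(1)
  show False by simp
qed

section \<open>Projected volumes of boxes and of unions of two boxes\<close>

lemma restrict_coord_proj_cbox:
  fixes a :: "real ^ 'n::finite"
  assumes "\<And>i. 0 \<le> a $ i"
  shows "(\<lambda>x. \<lambda>i\<in>S. x $ i) ` coord_proj S ` cbox 0 a = (\<Pi>\<^sub>E i\<in>S. {0..a $ i})"
proof (intro subset_antisym subsetI)
  fix f assume f: "f \<in> (\<Pi>\<^sub>E i\<in>S. {0..a $ i})"
  let ?x = "\<chi> i. if i \<in> S then f i else 0"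
  have "f = (\<lambda>i\<in>S. coord_proj S ?x $ i)"
    by (rule ext) (use PiE_arb[OF f] in \<open>simp add: coord_proj_def restrict_def\<close>)
  moreover have "?x \<in> cbox 0 a"
    using PiE_mem[OF f] assms by (simp add: mem_box_cart)
  ultimately show "f \<in> (\<lambda>x. \<lambda>i\<in>S. x $ i) ` coord_proj S ` cbox 0 a"
    unfolding image_image by (rule image_eqI)
qed (auto simp: coord_proj_def mem_box_cart)

text \<open>Each projection of the union is a union of two boxes, so its volume lies between the
  larger box volume and the sum, which differ by a factor of at most 2. The overlap need not be
  computed.\<close>

lemma coord_volume_Un_cbox:
  fixes a b :: "real ^ 'n::finite"
  assumes "\<And>i. 0 \<le> a $ i" "\<And>i. 0 \<le> b $ i"
  shows "(\<Prod>i\<in>S. a $ i) \<le> coord_volume S (coord_proj S ` (cbox 0 a \<union> cbox 0 b))"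
    and "(\<Prod>i\<in>S. b $ i) \<le> coord_volume S (coord_proj S ` (cbox 0 a \<union> cbox 0 b))"
    and "coord_volume S (coord_proj S ` (cbox 0 a \<union> cbox 0 b)) \<le> (\<Prod>i\<in>S. a $ i) + (\<Prod>i\<in>S. b $ i)"
proof -
  interpret product_sigma_finite "\<lambda>_::'n. lborel :: real measure" ..
  let ?M = "PiM S (\<lambda>_. lborel :: real measure)"
  let ?B = "\<lambda>a :: real ^ 'n. \<Pi>\<^sub>E i\<in>S. {0..a $ i}"
  have em: "emeasure ?M (?B c) = ennreal (\<Prod>i\<in>S. c $ i)" if "\<And>i. 0 \<le> c $ i" for c
    using that by (simp add: emeasure_PiM prod_ennreal)
  have m: "measure ?M (?B c) = (\<Prod>i\<in>S. c $ i)" if "\<And>i. 0 \<le> c $ i" for c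
    using that by (simp add: measure_def em prod_nonneg)
  have f: "?B c \<in> fmeasurable ?M" if "\<And>i. 0 \<le> c $ i" for c
    using that by (intro fmeasurableI) (auto simp: em intro!: sets_PiM_I_finite)
  have vol: "coord_volume S (coord_proj S ` (cbox 0 a \<union> cbox 0 b)) = measure ?M (?B a \<union> ?B b)"
    by (simp add: coord_volume_def image_Un restrict_coord_proj_cbox assms)
  note fa = f[of a, OF assms(1)] and fb = f[of b, OF assms(2)]
  have fu: "?B a \<union> ?B b \<in> fmeasurable ?M"
    using fa fb by (rule fmeasurable.Un)
  show "(\<Prod>i\<in>S. a $ i) \<le> coord_volume S (coord_proj S ` (cbox 0 a \<union> cbox 0 b))"
    unfolding vol m[of a, OF assms(1), symmetric]
    using fa fu by (intro measure_mono_fmeasurable) auto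
  show "(\<Prod>i\<in>S. b $ i) \<le> coord_volume S (coord_proj S ` (cbox 0 a \<union> cbox 0 b))"
    unfolding vol m[of b, OF assms(2), symmetric]
    using fb fu by (intro measure_mono_fmeasurable) auto
  show "coord_volume S (coord_proj S ` (cbox 0 a \<union> cbox 0 b)) \<le> (\<Prod>i\<in>S. a $ i) + (\<Prod>i\<in>S. b $ i)"
    unfolding vol m[of a, OF assms(1), symmetric] m[of b, OF assms(2), symmetric]
    using fa fb by (intro measure_Un_le) auto
qed

lemma coord_volume_cbox_one:
  "coord_volume S (coord_proj S ` cbox 0 (1 :: real ^ 'n::finite)) = 1"
proof -
  interpret product_sigma_finite "\<lambda>_::'n. lborel :: real measure" ..
  show ?thesis
    by (simp add: coord_volume_def restrict_coord_proj_cbox measure_def emeasure_PiM)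
qed

section \<open>Fourth roots from convexity, and the contradiction\<close>

lemma zero_in_Psi: "(0 :: real ^ ('n::finite) nonempty_set) \<in> Psi"
  unfolding Psi_def
  by (intro CollectI exI[of _ "cbox 0 (1 :: real ^ 'n)"])
    (auto simp: object_def coord_volume_cbox_one mem_box_cart)

text \<open>The point \<open>p / N\<close> lies on the segment from the origin to \<open>p\<close>,
  and dividing logarithms by \<open>N\<close> takes \<open>N\<close>-th roots of all volumes
  simultaneously.\<close>

lemma convex_Psi_root_volumes:
  fixes T :: "(real ^ 'n::finite) set" and N :: nat
  assumes "convex (Psi :: (real ^ 'n nonempty_set) set)" "object T" "0 < N"
    and pos: "\<And>S. S \<noteq> {} \<Longrightarrow> 0 < coord_volume S (coord_proj S ` T)"
  shows "\<exists>U :: (real ^ 'n) set. compact U \<and>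
    (\<forall>S. S \<noteq> {} \<longrightarrow> coord_volume S (coord_proj S ` U) ^ N = coord_volume S (coord_proj S ` T))"
proof -
  define p :: "real ^ 'n nonempty_set"
    where "p = (\<chi> S. ln (coord_volume (set_of S) (coord_proj (set_of S) ` T)))"
  have ne: "set_of S \<noteq> {}" for S :: "'n nonempty_set"
    using set_of[of S] by simp
  have "p \<in> Psi"
    unfolding Psi_def p_def using \<open>object T\<close> pos ne by auto
  then have "(1 / real N) *\<^sub>R p + (1 - 1 / real N) *\<^sub>R 0 \<in> Psi"
    using assms(1,3) zero_in_Psi by (intro convexD) (auto simp: field_simps)
  then obtain U :: "(real ^ 'n) set" where "object U"
    and U: "\<And>S. 0 < coord_volume (set_of S) (coord_proj (set_of S) ` U)"
      "\<And>S. p $ S / N = ln (coord_volume (set_of S) (coord_proj (set_of S) ` U))"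
    unfolding Psi_def by auto
  show ?thesis
  proof (intro exI[of _ U] conjI allI impI)
    show "compact U"
      using \<open>object U\<close> by (simp add: object_def)
    fix S :: "'n set" assume "S \<noteq> {}"
    then have S: "set_of (nonempty_set_of S) = S"
      by (simp add: nonempty_set_of_inverse)
    let ?u = "coord_volume S (coord_proj S ` U)" and ?t = "coord_volume S (coord_proj S ` T)"
    have "0 < ?u" "ln ?t / N = ln ?u"
      using U[of "nonempty_set_of S"] by (simp_all add: S p_def)
    then have "ln (?u ^ N) = ln ?t"
      using \<open>0 < N\<close> by (simp add: ln_realpow field_simps)
    then show "?u ^ N = ?t"
      using \<open>0 < ?u\<close> pos[OF \<open>S \<noteq> {}\<close>] by simp
  qed
qed

lemma four_distinct:
  assumes "4 \<le> CARD('n::finite)"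
  obtains i j k l :: "'n::finite" where "distinct [i, j, k, l]"
proof -
  obtain xs :: "'n list" where xs: "set xs = UNIV" "distinct xs"
    using finite_distinct_list[of "UNIV :: 'n set"] by auto
  then have "Suc (Suc (Suc (Suc 0))) \<le> length xs"
    using assms distinct_card[of xs] by simp
  then obtain i j k l ys where "xs = i # j # k # l # ys"
    unfolding Suc_le_length_iff by blast
  with xs(2) show thesis
    by (intro that[of i j k l]) auto
qed

theorem theorem4:
  assumes "4 \<le> CARD('n::finite)"
  shows "\<not> convex (Psi :: (real ^ 'n nonempty_set) set)"
proof
  assume convex: "convex (Psi :: (real ^ 'n nonempty_set) set)"
  obtain i j k l :: 'n where distinct: "distinct [i, j, k, l]"
    using four_distinct[OF assms] .
  \<comment> \<open>The fourth power of \<open>m = 1000\<close>, while \<open>2 \<le> c\<^sup>4\<close> for \<open>c = 6/5\<close>.\<close>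
  define M :: real where "M = 10 ^ 12"
  \<comment> \<open>Box \<open>a\<close> has sides \<open>M\<close>, \<open>1/M\<close>, 1 along
    \<open>i\<close>, \<open>j\<close>, \<open>k\<close>, hence volume 1 there; \<open>b\<close>
    does the same for \<open>j\<close>, \<open>i\<close>, \<open>l\<close>. The side
    \<open>1/M\<^sup>2\<close> in the fourth direction keeps each box from spoiling the areas wanted
    from the other: \<open>a\<close> has area \<open>1/M\<close> on \<open>{i, l}\<close> and
    \<open>b\<close> has area \<open>1/M\<close> on \<open>{j, k}\<close>, as large as the other box
    there.\<close>
  define a b :: "real ^ 'n"
    where "a = (\<chi> h. if h = i then M else if h = j then 1 / M else if h = l then 1 / M\<^sup>2 else 1)"
      and "b = (\<chi> h. if h = i then 1 / M else if h = j then M else if h = k then 1 / M\<^sup>2 else 1)"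
  define T where "T = cbox 0 a \<union> cbox 0 b"
  have apos: "0 < a $ h" and bpos: "0 < b $ h" for h
    by (simp_all add: a_def b_def M_def)
  note vol = coord_volume_Un_cbox[of a b, OF less_imp_le less_imp_le, OF apos bpos, folded T_def]
  have "object T"
    using apos bpos by (auto simp: object_def T_def mem_box_cart)
  have pos: "0 < coord_volume S (coord_proj S ` T)" if "S \<noteq> {}" for S
    using apos by (intro less_le_trans[OF prod_pos vol(1)]) simp
  obtain U :: "(real ^ 'n) set" where "compact U"
    and U: "\<And>S. S \<noteq> {} \<Longrightarrow> coord_volume S (coord_proj S ` U) ^ 4 = coord_volume S (coord_proj S ` T)"
    using convex_Psi_root_volumes[OF convex \<open>object T\<close> zero_less_numeral pos] by blast
  define V where "V S = coord_volume S (coord_proj S ` U)" for S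
  \<comment> \<open>Bounds on \<open>V\<close> are checked on fourth powers, which are the explicit
    volumes of \<open>T\<close>.\<close>
  have V_le: "V S \<le> r" if "S \<noteq> {}" "0 \<le> r" "(\<Prod>h\<in>S. a $ h) + (\<Prod>h\<in>S. b $ h) \<le> r ^ 4" for S r
  proof (rule power_le_imp_le_base)
    show "V S ^ Suc 3 \<le> r ^ Suc 3"
      using vol(3)[of S] U[OF that(1)] that(3) unfolding V_def by simp
  qed fact
  have V_ge: "1 \<le> V S" if "S \<noteq> {}" "1 \<le> (\<Prod>h\<in>S. a $ h) \<or> 1 \<le> (\<Prod>h\<in>S. b $ h)" for S
  proof (rule ccontr)
    assume "\<not> 1 \<le> V S"
    then have "V S ^ 4 < 1"
      by (intro power_less_one_iff[THEN iffD2]) (simp_all add: V_def coord_volume_def)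
    then show False
      using vol(1,2)[of S] U[OF that(1)] that(2) unfolding V_def by linarith
  qed
  have ne: "i \<noteq> j" "i \<noteq> k" "i \<noteq> l" "j \<noteq> k" "j \<noteq> l" "k \<noteq> l"
    "j \<noteq> i" "k \<noteq> i" "l \<noteq> i" "k \<noteq> j" "l \<noteq> j" "l \<noteq> k"
    using distinct by auto
  have "V {i, j, k} < 1 \<or> V {i, j, l} < 1"
    unfolding V_def
  proof (rule near_extremal_volumes_incompatible[OF \<open>compact U\<close> distinct], fold V_def)
    \<comment> \<open>In this order the sums of the two box areas are \<open>2\<close>,
      \<open>M + 1/M^3\<close>, \<open>2/M\<close>, \<open>2/M\<close> and \<open>M + 1/M^3\<close>.
      All fit because \<open>(6/5)^4 = 2.0736\<close> and \<open>M = 1000^4\<close>.\<close>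
    show "V {i, j} \<le> 6/5" "V {i, k} \<le> 1200" "V {j, k} \<le> 6/5000" "V {i, l} \<le> 6/5000" "V {j, l} \<le> 1200"
      by (intro V_le; simp add: ne a_def b_def M_def power_divide)+
  qed
  \<comment> \<open>Box \<open>a\<close> witnesses the first bound and box \<open>b\<close> the
    second.\<close>
  moreover have "1 \<le> V {i, j, k}" "1 \<le> V {i, j, l}"
    by (intro V_ge; simp add: ne a_def b_def M_def)+
  ultimately show False by linarith
qed

end
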